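(* For every $\theta>0$ there is $\delta>0$ such that for all sufficiently large $n$ the following holds. Let $\mathbf{w}:[n]\times[n]\to[0,1]$ be an edge weighting such that $$\sum_{\substack{i,j\in S\\ i<j}}w_{ij}\le |S|-1$$ for every nonempty vertex set $S\subseteq[n]$ that induces a clique in the positive-support graph of $\mathbf w$, and such that $$\sum_{1\le i<j\le n}w_{ij}\ge \left(\frac{1}{4}-\delta\right)n^2 .$$ Then there is a balanced bipartition $[n]=A\,\dot\cup\,B$ for which $$\sum_{a\in A,\ b\in B}(1-w_{ab})\le\theta n^2 .$$
   Context: An edge weighting is a map $\mathbf{w}:[n]\times[n]\to[0,1]$ with $w_{ij}=w_{ji}$ for $1\le i<j\le n$ and $w_{ii}=0$ for $1\le i\le n$. Its positive-support graph is the graph on $[n]$ in which $ij$ ($i\neq j$) is an edge exactly when $w_{ij}>0$. A bipartition $A\,\dot\cup\,B$ is balanced if $||A|-|B||\le 1$. *)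

theory Defs
  imports Complex_Main
begin

text \<open>The vertex set is \<open>{1..n}\<close>. A weighting is represented by a function on all pairs of
  naturals; its values outside \<open>{1..n} \<times> {1..n}\<close> are unconstrained and never used.\<close>

definition edge_weighting :: "nat \<Rightarrow> (nat \<Rightarrow> nat \<Rightarrow> real) \<Rightarrow> bool" where
  "edge_weighting n w \<longleftrightarrow>
     (\<forall>i\<in>{1..n}. \<forall>j\<in>{1..n}. w i j \<in> {0..1}) \<and>
     (\<forall>i\<in>{1..n}. \<forall>j\<in>{1..n}. w i j = w j i) \<and>
     (\<forall>i\<in>{1..n}. w i i = 0)"

definition positive_support :: "nat \<Rightarrow> (nat \<Rightarrow> nat \<Rightarrow> real) \<Rightarrow> nat set set" where
  "positive_support n w =
     {{i, j} | i j. i \<in> {1..n} \<and> j \<in> {1..n} \<and> i \<noteq> j \<and> w i j > 0}"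

definition induces_clique :: "'a set set \<Rightarrow> 'a set \<Rightarrow> bool" where
  "induces_clique E S \<longleftrightarrow> (\<forall>i\<in>S. \<forall>j\<in>S. i \<noteq> j \<longrightarrow> {i, j} \<in> E)"

definition weight_within :: "(nat \<Rightarrow> nat \<Rightarrow> real) \<Rightarrow> nat set \<Rightarrow> real" where
  "weight_within w S = (\<Sum>(i, j) \<in> {(i, j). i \<in> S \<and> j \<in> S \<and> i < j}. w i j)"

definition balanced_bipartition :: "'a set \<Rightarrow> 'a set \<Rightarrow> 'a set \<Rightarrow> bool" where
  "balanced_bipartition V A B \<longleftrightarrow>
     A \<union> B = V \<and> A \<inter> B = {} \<and> \<bar>int (card A) - int (card B)\<bar> \<le> 1"

end

theory Submission
  imports Defs
begin

text \<open>
  The constraint on cliques says that the weights on a clique lie in the forest polytope of that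
  clique. For nonnegative vertex masses \<open>x\<close>, forests therefore control the quadratic form
  \<open>\<Sum> w u v * x u * x v\<close> on a clique: the heaviest spanning tree for edge costs \<open>x u * x v\<close> is the
  star at a vertex of maximal mass \<open>m\<close>, so the form, summed over ordered pairs, is at most
  \<open>2 * m * (s - m) \<le> s\<^sup>2 / 2\<close> for total mass \<open>s\<close> (\<open>clique_min_bound\<close>, \<open>quad_clique_le\<close>). In general,
  two vertices of zero weight can be merged without decreasing the form, as in the proof of
  Motzkin and Straus, and the process ends on a clique (\<open>concentrate_on_clique\<close>). The same bound thus
  holds for all masses (\<open>quad_le_half\<close>); unit masses give total weight at most \<open>n\<^sup>2 / 4\<close>.

  Stability rests on finding one edge \<open>a b\<close> that is nearly saturated and whose ends have degree nearly
  \<open>n / 2\<close>. On a clique, near equality in the bound forces \<open>m\<close> to be near \<open>s / 2\<close> and, if every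
  weight is at most \<open>1 - \<eta>\<close>, also the second largest mass to be near \<open>s / 2\<close>; but then
  almost all of the form comes from that single pair, whose weight is too small
  (\<open>heavy_edge_in_clique\<close>). Since raising the mass of one vertex must not violate the general bound,
  no degree is much larger than \<open>n / 2\<close>, so few degrees are much smaller, and the merging process can
  be confined to vertices of good degree (\<open>exists_heavy_edge\<close>).

  Such an edge determines the structure. Put \<open>p v = w v a\<close>. Triangles on \<open>a b\<close> give \<open>w v a + w v b\<close>
  at most about 1, and the degrees of \<open>a\<close> and \<open>b\<close> make this nearly tight for almost all \<open>v\<close>. The
  constraints on the cliques inside \<open>{a, b, u, v}\<close> then show that \<open>w u v\<close> is at most about
  \<open>p u * (1 - p v) + p v * (1 - p u)\<close>, the probability that \<open>u\<close> and \<open>v\<close> are separated when each \<open>v\<close>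
  joins one side independently with probability \<open>p v\<close>; and that \<open>w u v\<close> is nearly 0 when
  both \<open>p u\<close> and \<open>p v\<close> are far from 0 and 1
  (\<open>weight_le_cut_probability\<close>, \<open>two_neighbours_light\<close>). Summed over all \<open>u\<close> and \<open>v\<close>, the
  expressions \<open>p u * (1 - p v) + p v * (1 - p u)\<close> give \<open>2 * P * (n - P) \<le> n\<^sup>2 / 2\<close>, where \<open>P = \<Sum> p\<close>. As
  the weights of the ordered pairs nearly add up to \<open>n\<^sup>2 / 2\<close>,
  \<open>P\<close> is near \<open>n / 2\<close>, almost every \<open>p v\<close> is near 0 or 1, and little weight is missing
  between these two classes (\<open>near_cut_of_profile\<close>). Moving few vertices balances the cut.
\<close>

section \<open>Counting and balancing\<close>

lemma attains_max:
  fixes f :: "'a \<Rightarrow> real"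
  assumes "finite S" "S \<noteq> {}"
  shows "\<exists>c\<in>S. \<forall>u\<in>S. f u \<le> f c"
  using assms Max_in[of "f ` S"] Max_ge[of "f ` S"] by fastforce

lemma sum_ge_card_mult:
  fixes f :: "'a \<Rightarrow> real"
  assumes "finite A" "B \<subseteq> A" "\<And>a. a \<in> A \<Longrightarrow> 0 \<le> f a" "\<And>b. b \<in> B \<Longrightarrow> c \<le> f b"
  shows "real (card B) * c \<le> (\<Sum>a\<in>A. f a)"
  using sum_bounded_below[of B c f] sum_mono2[of A B f] assms by fastforce

text \<open>If \<open>X\<close> has at least half of the vertices (rounded down), \<open>A\<close> is cut out of it; otherwise few vertices must be
  added to \<open>X\<close>. Either way \<open>A - X\<close> and \<open>B - Y\<close> are small, and each of their vertices adds at most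
  \<open>card V\<close> to the cost.\<close>

lemma exists_balanced_cut_close_to:
  fixes c :: "'a \<Rightarrow> 'a \<Rightarrow> real"
  assumes V: "finite V" and X: "X \<subseteq> V" and Y: "Y \<subseteq> V" and XY: "X \<inter> Y = {}"
    and c: "\<And>u v. u \<in> V \<Longrightarrow> v \<in> V \<Longrightarrow> 0 \<le> c u v" "\<And>u v. u \<in> V \<Longrightarrow> v \<in> V \<Longrightarrow> c u v \<le> 1"
    and large: "(1/2 - \<kappa>) * real (card V) \<le> real (card X)" "(1/2 - \<kappa>) * real (card V) \<le> real (card Y)"
    and \<kappa>: "0 \<le> \<kappa>"
  shows "\<exists>A B. balanced_bipartition V A B \<and>
    (\<Sum>a\<in>A. \<Sum>b\<in>B. c a b)
      \<le> (\<Sum>a\<in>X. \<Sum>b\<in>Y. c a b) + (3 * \<kappa> * real (card V) + 1) * real (card V)"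
proof -
  define N where "N = card V"
  define k where "k = N div 2"
  have fin: "finite X" "finite Y" using X Y V finite_subset by auto
  have "\<exists>A\<subseteq>V. card A = k \<and> real (card (A - X)) \<le> \<kappa> * N \<and> real (card (A \<inter> Y)) \<le> \<kappa> * N"
  proof (cases "k \<le> card X")
    case True
    then obtain A where A: "A \<subseteq> X" "card A = k" using obtain_subset_with_card_n by metis
    then have "A - X = {}" "A \<inter> Y = {}" using XY by auto
    with A X show ?thesis using \<kappa> by (metis card.empty mult_nonneg_nonneg of_nat_0 of_nat_0_le_iff subset_trans)
  next
    case False
    have "k - card X \<le> card (V - X)"
      using X V fin by (simp add: card_Diff_subset k_def N_def)
    then obtain C where C: "C \<subseteq> V - X" "card C = k - card X" using obtain_subset_with_card_n by metis
    have finC: "finite C" using C V finite_subset by blast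
    have "card (X \<union> C) = k" using C finC fin False by (subst card_Un_disjoint) auto
    have "real (card C) = real k - real (card X)" using C False by simp
    also have "\<dots> \<le> \<kappa> * N"
    proof -
      have "real k \<le> N / 2" by (simp add: k_def)
      then show ?thesis using large(1) by (simp add: N_def algebra_simps)
    qed
    finally have C_small: "real (card C) \<le> \<kappa> * N" .
    have "card (X \<union> C - X) \<le> card C" "card ((X \<union> C) \<inter> Y) \<le> card C"
      using XY finC by (auto intro!: card_mono)
    then show ?thesis
      using C_small \<open>card (X \<union> C) = k\<close> C X by (intro exI[of _ "X \<union> C"]) auto
  qed
  then obtain A where A: "A \<subseteq> V" "card A = k" "real (card (A - X)) \<le> \<kappa> * N"
    "real (card (A \<inter> Y)) \<le> \<kappa> * N" by blast
  define B where "B = V - A"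
  have finA: "finite A" and finB: "finite B" using A V finite_subset by (auto simp: B_def)
  have cB: "card B = N - k" using A V finA by (simp add: B_def card_Diff_subset N_def)
  have bal: "balanced_bipartition V A B"
    using A cB by (auto simp: balanced_bipartition_def B_def k_def)
  have BY: "real (card (B - Y)) \<le> 2 * \<kappa> * N + 1"
  proof -
    have "card (B - Y) + card (Y - A) = card B"
    proof (subst card_Un_disjoint[symmetric])
      show "card (B - Y \<union> (Y - A)) = card B" using Y by (intro arg_cong[of _ _ card]) (auto simp: B_def)
    qed (use finB fin in auto)
    moreover have "card (Y - A) + card (A \<inter> Y) = card Y"
    proof (subst card_Un_disjoint[symmetric])
      show "card (Y - A \<union> A \<inter> Y) = card Y" by (intro arg_cong[of _ _ card]) auto
    qed (use finA fin in auto)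
    moreover have "real (card B) \<le> N / 2 + 1"
    proof -
      have "2 * card B \<le> N + 2" using cB by (simp add: k_def)
      then show ?thesis by linarith
    qed
    ultimately show ?thesis using A(4) large(2) by (simp add: N_def algebra_simps)
  qed
  have "(\<Sum>a\<in>A. \<Sum>b\<in>B. c a b) = (\<Sum>z\<in>A \<times> B. c (fst z) (snd z))"
    by (simp add: sum.cartesian_product split_def)
  also have "\<dots> \<le> (\<Sum>z\<in>X \<times> Y \<union> ((A - X) \<times> V \<union> V \<times> (B - Y)). c (fst z) (snd z))"
    using A X Y fin V finA finB by (intro sum_mono2) (auto simp: B_def intro!: c)
  also have "\<dots> \<le> (\<Sum>z\<in>X \<times> Y. c (fst z) (snd z))
      + (\<Sum>z\<in>(A - X) \<times> V \<union> V \<times> (B - Y). c (fst z) (snd z))"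
    using A X Y fin V finA finB
    by (subst sum.union_inter[symmetric])
      (auto simp: B_def intro!: sum_nonneg c)
  also have "(\<Sum>z\<in>(A - X) \<times> V \<union> V \<times> (B - Y). c (fst z) (snd z))
      \<le> real (card ((A - X) \<times> V \<union> V \<times> (B - Y)))"
  proof -
    have "(\<Sum>z\<in>(A - X) \<times> V \<union> V \<times> (B - Y). c (fst z) (snd z))
      \<le> (\<Sum>z\<in>(A - X) \<times> V \<union> V \<times> (B - Y). 1)"
      using A by (intro sum_mono c) (auto simp: B_def)
    then show ?thesis by simp
  qed
  also have "\<dots> \<le> real (card ((A - X) \<times> V) + card (V \<times> (B - Y)))"
    using card_Un_le by (rule of_nat_mono)
  also have "\<dots> = (real (card (A - X)) + real (card (B - Y))) * N"
    by (simp add: card_cartesian_product N_def algebra_simps)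
  also have "\<dots> \<le> (3 * \<kappa> * N + 1) * N"
    using A(3) BY by (intro mult_right_mono) auto
  finally show ?thesis
    using bal by (auto simp: sum.cartesian_product split_def N_def)
qed

section \<open>The quadratic form of a clique-sparse weighting\<close>

text \<open>All sums run over ordered pairs, which accounts for the factor 2 in the clique constraint and
  makes \<open>1/2\<close> the extremal density below.\<close>

locale clique_sparse =
  fixes V :: "'a set" and w :: "'a \<Rightarrow> 'a \<Rightarrow> real"
  assumes finite_V: "finite V"
    and w_nonneg: "u \<in> V \<Longrightarrow> v \<in> V \<Longrightarrow> 0 \<le> w u v"
    and w_le_1: "u \<in> V \<Longrightarrow> v \<in> V \<Longrightarrow> w u v \<le> 1"
    and w_sym: "u \<in> V \<Longrightarrow> v \<in> V \<Longrightarrow> w u v = w v u"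
    and w_irrefl: "u \<in> V \<Longrightarrow> w u u = 0"
    and clique_weight: "S \<subseteq> V \<Longrightarrow> S \<noteq> {} \<Longrightarrow> (\<And>u v. u \<in> S \<Longrightarrow> v \<in> S \<Longrightarrow> u \<noteq> v \<Longrightarrow> 0 < w u v)
      \<Longrightarrow> (\<Sum>u\<in>S. \<Sum>v\<in>S. w u v) \<le> 2 * (real (card S) - 1)"
begin

definition clique :: "'a set \<Rightarrow> bool" where
  "clique S \<longleftrightarrow> S \<subseteq> V \<and> (\<forall>u\<in>S. \<forall>v\<in>S. u \<noteq> v \<longrightarrow> 0 < w u v)"

definition quad :: "'a set \<Rightarrow> ('a \<Rightarrow> real) \<Rightarrow> real" where
  "quad S x = (\<Sum>u\<in>S. \<Sum>v\<in>S. w u v * (x u * x v))"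

definition degree :: "'a \<Rightarrow> real" where
  "degree v = (\<Sum>u\<in>V. w v u)"

text \<open>This is the estimate by the star at \<open>c\<close>; it is strongest when \<open>y c\<close> is the maximum. The masses
  are peeled off in layers: lowering all of them by the minimum \<open>\<mu>\<close> costs at most
  \<open>2 * \<mu> * (card S - 1)\<close> by the clique constraint and removes a vertex from the support. These layers
  are the dual certificate that Kruskal's algorithm produces.\<close>

lemma clique_min_bound:
  assumes "clique S" and "\<And>u. u \<in> S \<Longrightarrow> 0 \<le> y u" and "c \<in> S"
  shows "(\<Sum>u\<in>S. \<Sum>v\<in>S. w u v * min (y u) (y v)) \<le> 2 * ((\<Sum>u\<in>S. y u) - y c)"
  using assms
proof (induction "card S" arbitrary: S y c rule: less_induct)
  case less
  have SV: "S \<subseteq> V" and finS: "finite S"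
    using less.prems(1) finite_V finite_subset by (auto simp: clique_def)
  have "\<exists>v0\<in>S. \<forall>u\<in>S. y v0 \<le> y u"
    using ex_min_if_finite[of "y ` S"] finS less.prems(3) by (force simp: not_less)
  then obtain v0 where v0: "v0 \<in> S" and v0_min: "\<And>u. u \<in> S \<Longrightarrow> y v0 \<le> y u" by blast
  define \<mu> where "\<mu> = y v0"
  define S' where "S' = S - {v0}"
  define z where "z u = y u - \<mu>" for u
  show ?case
  proof (cases "S' = {}")
    case True
    then have "S = {v0}" using v0 S'_def by auto
    then show ?thesis using w_irrefl less.prems(3) SV by auto
  next
    case False
    then obtain c0 where c0: "c0 \<in> S'" by auto
    \<comment> \<open>If \<open>c\<close> is the vertex removed, all masses equal or exceed \<open>y c\<close>, so any other vertex will do.\<close>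
    define c' where "c' = (if c = v0 then c0 else c)"
    have c': "c' \<in> S'" using c0 less.prems(3) by (auto simp: c'_def S'_def)
    have yc: "z c \<le> z c'"
      using v0_min c0 by (auto simp: c'_def S'_def z_def)
    have W: "(\<Sum>u\<in>S. \<Sum>v\<in>S. w u v) \<le> 2 * (real (card S) - 1)"
      using clique_weight[of S] less.prems(1) v0 by (auto simp: clique_def)
    have "\<mu> \<ge> 0" using less.prems(2) v0 \<mu>_def by simp
    have z0: "z v0 = 0" by (simp add: z_def \<mu>_def)
    have z_nonneg: "0 \<le> z u" if "u \<in> S" for u using v0_min that by (simp add: z_def \<mu>_def)
    have IH: "(\<Sum>u\<in>S'. \<Sum>v\<in>S'. w u v * min (z u) (z v)) \<le> 2 * ((\<Sum>u\<in>S'. z u) - z c')"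
    proof (rule less.hyps)
      show "card S' < card S" unfolding S'_def by (rule card_Diff1_less[OF finS v0])
      show "clique S'" using less.prems(1) by (auto simp: clique_def S'_def)
    qed (use z_nonneg c' in \<open>auto simp: S'_def\<close>)
    have inner: "(\<Sum>v\<in>S. w u v * min (z u) (z v)) = (\<Sum>v\<in>S'. w u v * min (z u) (z v))" if "u \<in> S" for u
      using sum.remove[OF finS v0, of "\<lambda>v. w u v * min (z u) (z v)"] z0 z_nonneg[OF that]
      by (simp add: S'_def)
    have "(\<Sum>u\<in>S. \<Sum>v\<in>S. w u v * min (z u) (z v)) = (\<Sum>u\<in>S. \<Sum>v\<in>S'. w u v * min (z u) (z v))"
      using inner by (rule sum.cong[OF refl])
    also have "\<dots> = (\<Sum>u\<in>S'. \<Sum>v\<in>S'. w u v * min (z u) (z v))"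
    proof -
      have "(\<Sum>v\<in>S'. w v0 v * min (z v0) (z v)) = 0"
        using z0 z_nonneg by (intro sum.neutral) (auto simp: S'_def)
      then show ?thesis
        using sum.remove[OF finS v0, of "\<lambda>u. \<Sum>v\<in>S'. w u v * min (z u) (z v)"] by (simp add: S'_def)
    qed
    finally have restrict: "(\<Sum>u\<in>S. \<Sum>v\<in>S. w u v * min (z u) (z v))
        = (\<Sum>u\<in>S'. \<Sum>v\<in>S'. w u v * min (z u) (z v))" .
    have "w u v * min (y u) (y v) = \<mu> * w u v + w u v * min (z u) (z v)" for u v
      by (simp add: z_def min_def algebra_simps)
    then have "(\<Sum>u\<in>S. \<Sum>v\<in>S. w u v * min (y u) (y v))
        = \<mu> * (\<Sum>u\<in>S. \<Sum>v\<in>S. w u v) + (\<Sum>u\<in>S. \<Sum>v\<in>S. w u v * min (z u) (z v))"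
      by (simp add: sum.distrib sum_distrib_left)
    also have "\<dots> \<le> \<mu> * (2 * (real (card S) - 1)) + 2 * ((\<Sum>u\<in>S'. z u) - z c')"
      using mult_left_mono[OF W \<open>\<mu> \<ge> 0\<close>] IH restrict by linarith
    also have "(\<Sum>u\<in>S'. z u) = (\<Sum>u\<in>S. y u) - real (card S) * \<mu>"
      using sum.remove[OF finS v0, of z] z0 by (simp add: S'_def z_def sum_subtractf)
    also have "\<mu> * (2 * (real (card S) - 1)) + 2 * ((\<Sum>u\<in>S. y u) - real (card S) * \<mu> - z c')
       \<le> 2 * ((\<Sum>u\<in>S. y u) - y c)"
      using yc by (simp add: z_def algebra_simps)
    finally show ?thesis .
  qed
qed

text \<open>The product of two masses is the smaller one times the larger one, and the larger one is at most
  \<open>y c\<close>.\<close>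

lemma quad_clique_le:
  assumes S: "clique S" and y: "\<And>u. u \<in> S \<Longrightarrow> 0 \<le> y u" and c: "c \<in> S"
    and c_max: "\<And>u. u \<in> S \<Longrightarrow> y u \<le> y c"
  shows "quad S y \<le> 2 * y c * ((\<Sum>u\<in>S. y u) - y c)"
proof -
  have "quad S y \<le> (\<Sum>u\<in>S. \<Sum>v\<in>S. y c * (w u v * min (y u) (y v)))"
    unfolding quad_def
  proof (intro sum_mono)
    fix u v assume uv: "u \<in> S" "v \<in> S"
    have "y u * y v = max (y u) (y v) * min (y u) (y v)" by (simp add: max_def min_def)
    also have "\<dots> \<le> y c * min (y u) (y v)"
      using uv c_max y by (intro mult_right_mono) auto
    finally show "w u v * (y u * y v) \<le> y c * (w u v * min (y u) (y v))"
      using mult_left_mono[of _ _ "w u v"] w_nonneg[of u v] S uv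
      by (fastforce simp: clique_def algebra_simps)
  qed
  also have "\<dots> = y c * (\<Sum>u\<in>S. \<Sum>v\<in>S. w u v * min (y u) (y v))"
    by (simp add: sum_distrib_left)
  also have "\<dots> \<le> y c * (2 * ((\<Sum>u\<in>S. y u) - y c))"
    using clique_min_bound[OF S y c] y[OF c] by (intro mult_left_mono)
  finally show ?thesis by (simp add: algebra_simps)
qed

lemma quad_insert:
  assumes "R \<subseteq> V" "u \<in> V" "u \<notin> R"
  shows "quad (insert u R) x = quad R x + 2 * x u * (\<Sum>z\<in>R. w u z * x z)"
proof -
  have fin: "finite R" using assms finite_V finite_subset by blast
  have "(\<Sum>z\<in>R. w z u * (x z * x u)) = x u * (\<Sum>z\<in>R. w u z * x z)"
    unfolding sum_distrib_left by (rule sum.cong) (use assms w_sym in \<open>auto simp: subset_iff\<close>)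
  moreover have "(\<Sum>z\<in>R. w u z * (x u * x z)) = x u * (\<Sum>z\<in>R. w u z * x z)"
    unfolding sum_distrib_left by (rule sum.cong) auto
  ultimately show ?thesis
    using fin assms w_irrefl[of u] by (simp add: quad_def sum.distrib)
qed

lemma quad_cong: "(\<And>u. u \<in> S \<Longrightarrow> x u = y u) \<Longrightarrow> quad S x = quad S y"
  by (simp add: quad_def)

text \<open>Along the direction that moves mass between \<open>u\<close> and \<open>v\<close> with \<open>w u v = 0\<close> the form is affine, so
  moving all mass to the better of the two does not decrease it. This removes one vertex from the
  support.\<close>

lemma concentrate_on_clique:
  assumes "U \<subseteq> V" "U \<noteq> {}" "\<And>u. u \<in> U \<Longrightarrow> 0 \<le> x u"
  shows "\<exists>S y. S \<subseteq> U \<and> S \<noteq> {} \<and> clique S \<and> (\<forall>u\<in>S. 0 \<le> y u)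
    \<and> (\<Sum>u\<in>S. y u) = (\<Sum>u\<in>U. x u) \<and> quad U x \<le> quad S y"
  using assms
proof (induction "card U" arbitrary: U x rule: less_induct)
  case less
  have finU: "finite U" using less.prems finite_V finite_subset by blast
  show ?case
  proof (cases "clique U")
    case True
    then show ?thesis using less.prems by blast
  next
    case False
    then obtain u0 v0 where uv0: "u0 \<in> U" "v0 \<in> U" "u0 \<noteq> v0" "\<not> 0 < w u0 v0"
      using less.prems by (auto simp: clique_def)
    define L where "L u = (\<Sum>z\<in>U - {u0, v0}. w u z * x z)" for u
    have "w u0 v0 = 0" using uv0 w_nonneg[of u0 v0] less.prems(1) by fastforce
    moreover have "w v0 u0 = w u0 v0" using w_sym uv0 less.prems(1) by blast
    ultimately obtain u v where uv: "u \<in> U" "v \<in> U" "u \<noteq> v" "w u v = 0" "w v u = 0"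
        "L v \<le> L u" and Ruv: "{u, v} = {u0, v0}"
      using uv0 by (metis insert_commute linear)
    define R where "R = U - {u, v}"
    define y where "y = x(u := x u + x v)"
    have R: "R \<subseteq> V" "u \<notin> R" "v \<notin> R" "v \<in> V" "u \<in> V" "insert u R \<subseteq> V" "finite R"
      using less.prems uv finU by (auto simp: R_def)
    have U: "U = insert v (insert u R)" using uv by (auto simp: R_def)
    have Ldef: "L t = (\<Sum>z\<in>R. w t z * x z)" for t using Ruv by (simp add: L_def R_def)
    have cong: "quad R y = quad R x" "(\<Sum>z\<in>R. w u z * y z) = (\<Sum>z\<in>R. w u z * x z)"
        "(\<Sum>z\<in>R. y z) = (\<Sum>z\<in>R. x z)"
      using R by (auto intro!: quad_cong sum.cong simp: y_def)
    have qU: "quad U x = quad R x + 2 * x u * L u + 2 * x v * L v"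
      using R uv by (simp add: U quad_insert Ldef)
    have qy: "quad (insert u R) y = quad R x + 2 * (x u + x v) * L u"
      using R uv cong by (simp add: quad_insert Ldef) (simp add: y_def)
    have "x v * L v \<le> x v * L u" using uv less.prems by (intro mult_left_mono) auto
    then have le: "quad U x \<le> quad (insert u R) y" using qU qy by (simp add: algebra_simps)
    have sums: "(\<Sum>z\<in>insert u R. y z) = (\<Sum>z\<in>U. x z)"
      using R uv cong by (simp add: U) (simp add: y_def)
    have "\<exists>S y'. S \<subseteq> insert u R \<and> S \<noteq> {} \<and> clique S \<and> (\<forall>u\<in>S. 0 \<le> y' u)
      \<and> (\<Sum>u\<in>S. y' u) = (\<Sum>u\<in>insert u R. y u) \<and> quad (insert u R) y \<le> quad S y'"
    proof (rule less.hyps)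
      show "card (insert u R) < card U" using R uv by (simp add: U)
      show "\<And>t. t \<in> insert u R \<Longrightarrow> 0 \<le> y t"
        using less.prems(3) U by (auto simp: y_def)
    qed (use R in auto)
    then obtain S y' where S: "S \<subseteq> insert u R \<and> S \<noteq> {} \<and> clique S \<and> (\<forall>u\<in>S. 0 \<le> y' u)
      \<and> (\<Sum>u\<in>S. y' u) = (\<Sum>u\<in>insert u R. y u) \<and> quad (insert u R) y \<le> quad S y'" by blast
    show ?thesis
      by (rule exI[of _ S], rule exI[of _ y']) (use S le sums U in auto)
  qed
qed

lemma quad_clique_le_half:
  assumes S: "clique S" "S \<noteq> {}" and y: "\<And>u. u \<in> S \<Longrightarrow> 0 \<le> y u"
  shows "quad S y \<le> (\<Sum>u\<in>S. y u)\<^sup>2 / 2"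
proof -
  have "finite S" using S finite_V finite_subset by (auto simp: clique_def)
  then have "\<exists>c\<in>S. \<forall>u\<in>S. y u \<le> y c"
    using S by (intro attains_max) auto
  then obtain c where c: "c \<in> S" "\<And>u. u \<in> S \<Longrightarrow> y u \<le> y c" by blast
  have "quad S y \<le> 2 * y c * ((\<Sum>u\<in>S. y u) - y c)"
    using S(1) y c by (rule quad_clique_le)
  also have "\<dots> \<le> (\<Sum>u\<in>S. y u)\<^sup>2 / 2"
    using zero_le_power2[of "(\<Sum>u\<in>S. y u) - 2 * y c"] by (simp add: power2_eq_square algebra_simps)
  finally show ?thesis .
qed

lemma quad_le_half:
  assumes "U \<subseteq> V" "\<And>u. u \<in> U \<Longrightarrow> 0 \<le> x u"
  shows "quad U x \<le> (\<Sum>u\<in>U. x u)\<^sup>2 / 2"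
proof (cases "U = {}")
  case False
  then obtain S y where "S \<noteq> {}" "clique S" "\<forall>u\<in>S. 0 \<le> y u"
    "(\<Sum>u\<in>S. y u) = (\<Sum>u\<in>U. x u)" "quad U x \<le> quad S y"
    using concentrate_on_clique[of U x] assms by blast
  then show ?thesis using quad_clique_le_half[of S y] by auto
qed (simp add: quad_def)

section \<open>A nearly saturated edge between vertices of good degree\<close>

text \<open>Let \<open>m \<ge> z\<close> be the two largest masses. If all weights are at most \<open>1 - \<eta>\<close>, the star estimate
  loses \<open>2 * \<eta> * (1 - m) * (m - z)\<close>, because the star at the heaviest vertex cannot be filled and the
  other pairs are only worth a factor \<open>z\<close> instead of \<open>m\<close>. So a nearly extremal clique has \<open>m\<close> and \<open>z\<close>
  close to \<open>1/2\<close>, where the trivial bound \<open>(1 - \<eta>) * (1 - m\<^sup>2 - z\<^sup>2)\<close> is too small.\<close>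

lemma heavy_edge_in_clique:
  assumes S: "clique S" and y: "\<And>u. u \<in> S \<Longrightarrow> 0 \<le> y u" and total: "(\<Sum>u\<in>S. y u) = 1"
    and \<eta>: "0 < \<eta>" "\<eta> \<le> 1" and large: "1/2 - \<eta>\<^sup>2 / 200 \<le> quad S y"
  shows "\<exists>a\<in>S. \<exists>b\<in>S. 1 - \<eta> < w a b"
proof (rule ccontr)
  assume "\<not> ?thesis"
  then have light: "w a b \<le> 1 - \<eta>" if "a \<in> S" "b \<in> S" for a b using that by (meson not_less)
  have SV: "S \<subseteq> V" and finS: "finite S"
    using S finite_V finite_subset by (auto simp: clique_def)
  have "S \<noteq> {}" using total by auto
  then have "\<exists>c\<in>S. \<forall>u\<in>S. y u \<le> y c"
    using \<open>S \<noteq> {}\<close> finS by (intro attains_max)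
  then obtain c where c: "c \<in> S" "\<And>u. u \<in> S \<Longrightarrow> y u \<le> y c" by blast
  define R where "R = S - {c}"
  have R: "R \<subseteq> V" "c \<notin> R" "c \<in> V" "finite R" and SR: "S = insert c R"
    using SV c finS by (auto simp: R_def)
  have \<eta>2: "\<eta>\<^sup>2 \<le> \<eta>" using \<eta> by (simp add: power2_eq_square mult_left_le)
  have "R \<noteq> {}"
  proof
    assume "R = {}"
    then have "quad S y = 0" using SR w_irrefl R by (simp add: quad_def)
    then show False using large \<eta> \<eta>2 by linarith
  qed
  then have "\<exists>d\<in>R. \<forall>u\<in>R. y u \<le> y d"
    using \<open>R \<noteq> {}\<close> R by (intro attains_max)
  then obtain d where d: "d \<in> R" "\<And>u. u \<in> R \<Longrightarrow> y u \<le> y d" by blast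
  define m where "m = y c"
  define z where "z = y d"
  have z: "0 \<le> z" "z \<le> m" using d c y SR by (auto simp: z_def m_def)
  have sumR: "(\<Sum>u\<in>R. y u) = 1 - m" using total R by (simp add: SR m_def)
  have m1: "m \<le> 1" using sumR y sum_nonneg[of R y] SR by auto
  define K where "K = (\<Sum>v\<in>R. w c v * y v)"
  define Q where "Q = (\<Sum>u\<in>R. \<Sum>v\<in>R. w u v * min (y u) (y v))"
  have K_light: "K \<le> (1 - \<eta>) * (1 - m)"
  proof -
    have "K \<le> (\<Sum>v\<in>R. (1 - \<eta>) * y v)"
      unfolding K_def using light y SR by (intro sum_mono mult_right_mono) auto
    then show ?thesis using sumR by (simp add: sum_distrib_left[symmetric])
  qed
  have forest: "2 * K + Q \<le> 2 * (1 - m)"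
  proof -
    have "(\<Sum>v\<in>R. w v c * min (y v) (y c)) = K" "(\<Sum>v\<in>R. w c v * min (y c) (y v)) = K"
      unfolding K_def using c SR w_sym R
      by (auto intro!: sum.cong simp: min_absorb1 min_absorb2 subset_iff)
    then have "(\<Sum>u\<in>S. \<Sum>v\<in>S. w u v * min (y u) (y v)) = 2 * K + Q"
      using R w_irrefl by (simp add: SR sum.distrib Q_def)
    then show ?thesis using clique_min_bound[of S y c, OF S _ c(1)] y total by (simp add: m_def)
  qed
  have "quad R y \<le> (\<Sum>u\<in>R. \<Sum>v\<in>R. z * (w u v * min (y u) (y v)))"
    unfolding quad_def
  proof (intro sum_mono)
    fix u v assume uv: "u \<in> R" "v \<in> R"
    have "y u * y v = max (y u) (y v) * min (y u) (y v)" by (simp add: max_def min_def)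
    also have "\<dots> \<le> z * min (y u) (y v)"
      using uv d y SR by (intro mult_right_mono) (auto simp: z_def)
    finally show "w u v * (y u * y v) \<le> z * (w u v * min (y u) (y v))"
      using mult_left_mono[of _ _ "w u v"] w_nonneg[of u v] R uv
      by (fastforce simp: algebra_simps)
  qed
  then have "quad R y \<le> z * Q" by (simp add: sum_distrib_left Q_def)
  then have "quad S y \<le> z * Q + 2 * m * K"
    using quad_insert[of R c y] R by (simp add: SR K_def m_def)
  also have "\<dots> \<le> z * (2 * (1 - m) - 2 * K) + 2 * m * K"
    using forest z by (intro add_right_mono mult_left_mono) auto
  also have "\<dots> = 2 * z * (1 - m) + 2 * (m - z) * K" by (simp add: algebra_simps)
  also have "\<dots> \<le> 2 * z * (1 - m) + 2 * (m - z) * ((1 - \<eta>) * (1 - m))"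
    using K_light z by (intro add_left_mono mult_left_mono) auto
  also have "\<dots> = 2 * m * (1 - m) - 2 * \<eta> * (1 - m) * (m - z)" by (simp add: algebra_simps)
  finally have q1: "quad S y \<le> 2 * m * (1 - m) - 2 * \<eta> * (1 - m) * (m - z)" .
  have q2: "quad S y \<le> (1 - \<eta>) * (1 - m\<^sup>2 - z\<^sup>2)"
  proof -
    have "quad S y \<le> (\<Sum>u\<in>S. \<Sum>v\<in>S. (1 - \<eta>) * (y u * y v - (if u = v then (y u)\<^sup>2 else 0)))"
      unfolding quad_def
      using light y w_irrefl SV
      by (intro sum_mono) (auto simp: power2_eq_square intro!: mult_right_mono)
    also have "\<dots> = (1 - \<eta>) * ((\<Sum>u\<in>S. y u)\<^sup>2 - (\<Sum>u\<in>S. (y u)\<^sup>2))"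
      using finS by (simp add: sum_distrib_left[symmetric] sum_subtractf power2_eq_square sum_product)
    also have "\<dots> \<le> (1 - \<eta>) * (1 - (m\<^sup>2 + z\<^sup>2))"
    proof -
      have "(\<Sum>u\<in>{c, d}. (y u)\<^sup>2) \<le> (\<Sum>u\<in>S. (y u)\<^sup>2)"
        using finS d c SR by (intro sum_mono2) auto
      moreover have "c \<noteq> d" using d R by auto
      ultimately show ?thesis using \<eta> total by (intro mult_left_mono) (auto simp: m_def z_def)
    qed
    finally show ?thesis by (simp add: algebra_simps)
  qed
  have pos: "0 \<le> \<eta> * (1 - m) * (m - z)" using \<eta> z m1 by simp
  have "(m - 1/2)\<^sup>2 \<le> (\<eta> / 20)\<^sup>2"
    using q1 large pos by (simp add: power2_eq_square algebra_simps)
  then have "\<bar>m - 1/2\<bar> \<le> \<eta> / 20"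
    using \<eta> by (simp add: abs_le_square_iff[symmetric])
  then have m: "1/2 - \<eta>/20 \<le> m" "m \<le> 1/2 + \<eta>/20" by linarith+
  have "2 * m * (1 - m) \<le> 1/2"
    using zero_le_power2[of "1 - 2 * m"] by (simp add: power2_eq_square algebra_simps)
  then have "\<eta> * ((1 - m) * (m - z)) \<le> \<eta> * (\<eta> / 400)"
    using q1 large by (simp add: power2_eq_square algebra_simps)
  then have "(1 - m) * (m - z) \<le> \<eta> / 400" using \<eta>(1) by (rule mult_left_le_imp_le)
  moreover have "(2/5) * (m - z) \<le> (1 - m) * (m - z)"
    using m \<eta> z by (intro mult_right_mono) auto
  ultimately have "(2/5) * (m - z) \<le> \<eta> / 400" by (rule order_trans[rotated])
  then have z': "1/2 - \<eta>/16 \<le> z" using m \<eta> by (simp add: algebra_simps)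
  have sq: "m\<^sup>2 \<ge> m - 1/4" "z\<^sup>2 \<ge> z - 1/4"
    using zero_le_power2[of "m - 1/2"] zero_le_power2[of "z - 1/2"]
    by (auto simp: power2_eq_square algebra_simps)
  have "1 - m\<^sup>2 - z\<^sup>2 \<le> 1/2 + \<eta>/8" using sq m z' \<eta> by linarith
  then have "quad S y \<le> (1 - \<eta>) * (1/2 + \<eta>/8)"
    using q2 mult_left_mono[of "1 - m\<^sup>2 - z\<^sup>2" "1/2 + \<eta>/8" "1 - \<eta>"] \<eta> by linarith
  then have "quad S y \<le> 1/2 - 3/8 * \<eta> - \<eta>\<^sup>2/8" by (simp add: power2_eq_square field_simps)
  then show False using large \<eta>(1) zero_le_power2[of \<eta>] by linarith
qed

lemma degree_le_card: "v \<in> V \<Longrightarrow> degree v \<le> real (card V)"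
  using sum_bounded_above[of V "w v" 1] w_le_1 by (simp add: degree_def)

text \<open>Give \<open>v\<close> the mass \<open>1 + \<tau> * n\<close> and every other vertex the mass 1: the gain
  \<open>2 * \<tau> * n * degree v\<close> of the form must fit into \<open>(n + \<tau> * n)\<^sup>2 / 2\<close>.\<close>

lemma degree_le:
  assumes total: "(1/2 - \<tau>\<^sup>2) * (real (card V))\<^sup>2 \<le> (\<Sum>u\<in>V. degree u)"
    and \<tau>: "0 < \<tau>" and v: "v \<in> V"
  shows "degree v \<le> (1/2 + \<tau>) * real (card V)"
proof -
  define N where "N = real (card V)"
  have N: "0 < N" using v finite_V by (auto simp: N_def card_gt_0_iff)
  define s where "s = \<tau> * N"
  define R where "R = V - {v}"
  have R: "R \<subseteq> V" "v \<notin> R" "finite R" and VR: "V = insert v R" using v finite_V by (auto simp: R_def)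
  define x where "x = (\<lambda>_. 1::real)(v := 1 + s)"
  have xR: "x z = 1" if "z \<in> R" for z using that R by (auto simp: x_def)
  have deg: "degree v = (\<Sum>z\<in>R. w v z)"
    using R w_irrefl[OF v] arg_cong[OF VR, of "sum (w v)"] by (simp add: degree_def)
  have "quad V x = quad R x + 2 * (1 + s) * (\<Sum>z\<in>R. w v z * x z)"
    using quad_insert[of R v x] R v by (simp add: VR x_def)
  also have "(\<Sum>z\<in>R. w v z * x z) = degree v" unfolding deg using xR by (intro sum.cong) auto
  also have "quad R x = quad R (\<lambda>_. 1)" using xR by (intro quad_cong) auto
  finally have qx: "quad V x = quad R (\<lambda>_. 1) + 2 * (1 + s) * degree v" .
  have "quad V (\<lambda>_. 1) = quad R (\<lambda>_. 1) + 2 * degree v"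
    using quad_insert[of R v "\<lambda>_. 1"] R v by (simp flip: VR deg)
  moreover have "quad V (\<lambda>_. 1) = (\<Sum>u\<in>V. degree u)" by (simp add: quad_def degree_def)
  ultimately have q: "quad V x = (\<Sum>u\<in>V. degree u) + 2 * s * degree v"
    using qx by (simp add: algebra_simps)
  have "(\<Sum>u\<in>V. x u) = N + s"
  proof -
    have "(\<Sum>u\<in>R. x u) = real (card R)" using xR by simp
    then show ?thesis using R by (simp add: VR x_def N_def)
  qed
  moreover have "quad V x \<le> (\<Sum>u\<in>V. x u)\<^sup>2 / 2"
    using \<tau> N by (intro quad_le_half) (auto simp: x_def s_def)
  ultimately have "2 * s * degree v \<le> (N + s)\<^sup>2 / 2 - (1/2 - \<tau>\<^sup>2) * N\<^sup>2"
    using q total by (simp add: N_def)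
  also have "\<dots> = 2 * s * ((1/2 + 3/4 * \<tau>) * N)"
    by (simp add: s_def power2_eq_square field_simps)
  finally have "degree v \<le> (1/2 + 3/4 * \<tau>) * N"
    using \<tau> N by (simp add: s_def)
  also have "\<dots> \<le> (1/2 + \<tau>) * N" using \<tau> N by (intro mult_right_mono) auto
  finally show ?thesis by (simp add: N_def)
qed

text \<open>The average degree is close to the upper bound for all degrees, so Markov's inequality applies.\<close>

lemma few_low_degree:
  assumes total: "(1/2 - \<tau>\<^sup>2) * (real (card V))\<^sup>2 \<le> (\<Sum>u\<in>V. degree u)"
    and \<tau>: "0 < \<tau>" "\<tau> \<le> 1"
  shows "real (card {v\<in>V. degree v < (1/2 - \<beta>) * real (card V)}) * \<beta> \<le> 2 * \<tau> * real (card V)"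
proof (cases "V = {}")
  case False
  define N where "N = real (card V)"
  have N: "0 < N" using False finite_V by (auto simp: N_def card_gt_0_iff)
  define L where "L = {v\<in>V. degree v < (1/2 - \<beta>) * N}"
  have "real (card L) * (\<beta> * N) \<le> (\<Sum>v\<in>V. (1/2 + \<tau>) * N - degree v)"
  proof (rule sum_ge_card_mult)
    show "0 \<le> (1/2 + \<tau>) * N - degree v" if "v \<in> V" for v
      using degree_le[OF total \<tau>(1) that] by (simp add: N_def)
    show "\<beta> * N \<le> (1/2 + \<tau>) * N - degree v" if "v \<in> L" for v
    proof -
      have "0 < \<tau> * N" using \<tau> N by simp
      then show ?thesis using that by (simp add: L_def algebra_simps)
    qed
  qed (auto simp: L_def finite_V)
  also have "\<dots> = (1/2 + \<tau>) * N\<^sup>2 - (\<Sum>v\<in>V. degree v)"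
    by (simp add: sum_subtractf N_def power2_eq_square)
  also have "\<dots> \<le> (\<tau> + \<tau>\<^sup>2) * N\<^sup>2" using total by (simp add: N_def algebra_simps)
  also have "\<dots> \<le> (2 * \<tau>) * N\<^sup>2"
    using \<tau> by (intro mult_right_mono) (auto simp: power2_eq_square mult_left_le)
  finally have "(real (card L) * \<beta>) * N \<le> (2 * \<tau> * N) * N" by (simp add: power2_eq_square algebra_simps)
  then show ?thesis using N by (simp add: L_def N_def)
qed simp

text \<open>Deleting the few vertices of low degree hardly changes the total weight, and uniform mass on the
  rest is then nearly extremal for the form. The clique on which it concentrates contains the edge.\<close>

lemma exists_heavy_edge:
  assumes total: "(1/2 - \<tau>\<^sup>2) * (real (card V))\<^sup>2 \<le> (\<Sum>u\<in>V. degree u)"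
    and \<tau>: "0 < \<tau>" "\<tau> \<le> 1" and \<beta>: "0 < \<beta>" and \<eta>: "0 < \<eta>" "\<eta> \<le> 1"
    and small: "\<tau>\<^sup>2 + 4 * \<tau> / \<beta> \<le> \<eta>\<^sup>2 / 200" and V: "V \<noteq> {}"
  shows "\<exists>a\<in>V. \<exists>b\<in>V. 1 - \<eta> < w a b
    \<and> (1/2 - \<beta>) * real (card V) \<le> degree a \<and> (1/2 - \<beta>) * real (card V) \<le> degree b"
proof -
  define N where "N = real (card V)"
  have N: "0 < N" using V finite_V by (auto simp: N_def card_gt_0_iff)
  define L where "L = {v\<in>V. degree v < (1/2 - \<beta>) * N}"
  define U where "U = V - L"
  have L: "L \<subseteq> V" and U: "U \<subseteq> V" and VU: "V = U \<union> L" "U \<inter> L = {}" by (auto simp: L_def U_def)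
  have fin: "finite U" "finite L" using L U finite_V finite_subset by blast+
  have "real (card L) * \<beta> \<le> 2 * \<tau> * N"
    using few_low_degree[OF total \<tau>] by (simp add: L_def N_def)
  then have cardL: "real (card L) \<le> 2 * \<tau> / \<beta> * N"
    using \<beta> by (simp add: field_simps)
  define Q where "Q = quad U (\<lambda>_. 1)"
  have "(\<Sum>u\<in>V. degree u) = (\<Sum>u\<in>U. \<Sum>v\<in>V. w u v) + (\<Sum>u\<in>L. degree u)"
    unfolding degree_def[symmetric] using sum.union_disjoint[of U L degree] fin VU(2)
    by (simp flip: VU(1))
  also have "(\<Sum>u\<in>U. \<Sum>v\<in>V. w u v) = Q + (\<Sum>u\<in>U. \<Sum>v\<in>L. w u v)"
    using fin VU by (simp add: Q_def quad_def sum.union_disjoint sum.distrib)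
  also have "(\<Sum>u\<in>U. \<Sum>v\<in>L. w u v) = (\<Sum>v\<in>L. \<Sum>u\<in>U. w v u)"
    using U L by (subst sum.swap) (auto intro!: sum.cong w_sym)
  also have "(\<Sum>v\<in>L. \<Sum>u\<in>U. w v u) \<le> (\<Sum>v\<in>L. degree v)"
    unfolding degree_def using U L finite_V by (intro sum_mono sum_mono2) (auto intro: w_nonneg)
  also have "(\<Sum>v\<in>L. degree v) \<le> real (card L) * N"
    using sum_bounded_above[of L degree N] degree_le_card L by (auto simp: N_def)
  finally have "(\<Sum>u\<in>V. degree u) \<le> Q + 2 * (real (card L) * N)" by (simp only: mult_2 add.assoc)
  also have "real (card L) * N \<le> 2 * \<tau> / \<beta> * N * N"
    using cardL N by (intro mult_right_mono) auto
  finally have "(1/2 - \<tau>\<^sup>2 - 4 * \<tau> / \<beta>) * N\<^sup>2 \<le> Q"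
    using total by (simp add: N_def power2_eq_square left_diff_distrib)
  moreover have "(1/2 - \<eta>\<^sup>2/200) * N\<^sup>2 \<le> (1/2 - \<tau>\<^sup>2 - 4 * \<tau> / \<beta>) * N\<^sup>2"
    using small by (intro mult_right_mono) auto
  ultimately have Q: "(1/2 - \<eta>\<^sup>2/200) * N\<^sup>2 \<le> Q" by linarith
  have "\<eta>\<^sup>2 \<le> 1" using \<eta> by (simp add: power_le_one)
  then have "0 < (1/2 - \<eta>\<^sup>2/200) * N\<^sup>2" using N by simp
  then have "0 < Q" using Q by linarith
  then have Une: "U \<noteq> {}" by (auto simp: Q_def quad_def)
  define k where "k = real (card U)"
  have k: "0 < k" "k \<le> N" using Une fin U finite_V by (auto simp: k_def N_def card_gt_0_iff intro: card_mono)
  define x where "x = (\<lambda>_::'a. 1 / k)"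
  have qx: "quad U x = Q / k\<^sup>2"
    by (simp add: quad_def Q_def x_def power2_eq_square sum_divide_distrib)
  have "1/2 - \<eta>\<^sup>2/200 \<le> Q / N\<^sup>2" using Q N by (simp add: field_simps)
  also have "\<dots> \<le> Q / k\<^sup>2"
    using \<open>0 < Q\<close> k N by (intro divide_left_mono power_mono mult_pos_pos) auto
  finally have qx_large: "1/2 - \<eta>\<^sup>2/200 \<le> quad U x" using qx by simp
  obtain S y where S: "S \<subseteq> U" "clique S" "\<forall>u\<in>S. 0 \<le> y u"
      "(\<Sum>u\<in>S. y u) = (\<Sum>u\<in>U. x u)" "quad U x \<le> quad S y"
    using concentrate_on_clique[OF U Une, of x] k by (auto simp: x_def)
  have "(\<Sum>u\<in>U. x u) = 1" using k by (simp add: x_def k_def)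
  then obtain a b where "a \<in> S" "b \<in> S" "1 - \<eta> < w a b"
    using heavy_edge_in_clique[OF S(2), of y \<eta>] S \<eta> qx_large by auto
  moreover from this have "a \<in> U" "b \<in> U" using S(1) by auto
  moreover have "u \<in> V" "(1/2 - \<beta>) * real (card V) \<le> degree u" if "u \<in> U" for u
    using that by (auto simp: U_def L_def N_def)
  ultimately show ?thesis by blast
qed

section \<open>The profile of the vertices with respect to an edge\<close>

lemma triangle_weight:
  assumes "x \<in> V" "y \<in> V" "z \<in> V" "0 < w x y" "0 < w x z" "0 < w y z"
  shows "w x y + w x z + w y z \<le> 2"
proof -
  have d: "x \<noteq> y" "x \<noteq> z" "y \<noteq> z" using assms w_irrefl by force+
  have s: "w y x = w x y" "w z x = w x z" "w z y = w y z" using assms w_sym by auto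
  show ?thesis
    using clique_weight[of "{x, y, z}"] assms d s w_irrefl by fastforce
qed

lemma K4_weight:
  assumes V: "x \<in> V" "y \<in> V" "z \<in> V" "t \<in> V"
    and pos: "0 < w x y" "0 < w x z" "0 < w x t" "0 < w y z" "0 < w y t" "0 < w z t"
  shows "w x y + w x z + w x t + w y z + w y t + w z t \<le> 3"
proof -
  have d: "x \<noteq> y" "x \<noteq> z" "x \<noteq> t" "y \<noteq> z" "y \<noteq> t" "z \<noteq> t" using assms w_irrefl by force+
  have s: "w y x = w x y" "w z x = w x z" "w z y = w y z" "w t x = w x t" "w t y = w y t" "w t z = w z t"
    using V w_sym by auto
  show ?thesis
  proof -
    have "(\<Sum>u\<in>{x, y, z, t}. \<Sum>v\<in>{x, y, z, t}. w u v) \<le> 2 * (real (card {x, y, z, t}) - 1)"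
      by (rule clique_weight) (use V pos s in auto)
    then show ?thesis using V d s w_irrefl by simp
  qed
qed

lemma two_neighbours_light:
  assumes V: "a \<in> V" "b \<in> V" "u \<in> V" "v \<in> V" and ab: "1 - \<epsilon> \<le> w a b" and \<epsilon>: "\<epsilon> < 1" "0 \<le> \<epsilon>"
    and u: "1 - \<epsilon> \<le> w u a + w u b" and v: "1 - \<epsilon> \<le> w v a + w v b"
    and pos: "0 < w u a" "0 < w u b" "0 < w v a" "0 < w v b"
  shows "w u v \<le> 3 * \<epsilon>"
proof (cases "0 < w u v")
  case True
  have "w u v + w u a + w u b + w v a + w v b + w a b \<le> 3"
    using K4_weight[of u v a b] V pos True ab \<epsilon> by auto
  then show ?thesis using ab u v by linarith
qed (use \<epsilon> in auto)

text \<open>A vertex whose two weights towards \<open>a\<close> and \<open>b\<close> add up to nearly 1 has positive weight towards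
  both, or is joined to just one of them, by nearly full weight. If both \<open>u\<close> and \<open>v\<close> are of the first
  kind, the clique \<open>{a, b, u, v}\<close> leaves almost nothing for \<open>w u v\<close>. If one of them is of the second kind
  and the other has positive weight towards the same end, the triangle on this end gives the bound.
  In the remaining case \<open>u\<close> and \<open>v\<close> are joined to different ends only, and the right-hand side is
  nearly 1.\<close>

lemma weight_le_cut_probability:
  assumes V: "a \<in> V" "b \<in> V" "u \<in> V" "v \<in> V" and ab: "1 - \<epsilon> \<le> w a b" and \<epsilon>: "\<epsilon> < 1" "0 \<le> \<epsilon>"
    and u: "1 - \<epsilon> \<le> w u a + w u b" and v: "1 - \<epsilon> \<le> w v a + w v b"
  shows "w u v \<le> w u a * (1 - w v a) + w v a * (1 - w u a) + 3 * \<epsilon>"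
proof -
  have r: "0 \<le> w u a" "w u a \<le> 1" "0 \<le> w v a" "w v a \<le> 1" "0 \<le> w u b" "w u b \<le> 1"
     "0 \<le> w v b" "w v b \<le> 1" "w u v \<le> 1"
    using V w_nonneg w_le_1 by auto
  have g: "0 \<le> w u a * (1 - w v a)" "0 \<le> w v a * (1 - w u a)" using r by auto
  have tri: "w s t \<le> 2 - w s c - w t c \<or> w s t = 0"
    if "s \<in> V" "t \<in> V" "c \<in> V" "0 < w s c" "0 < w t c" for s t c
    using triangle_weight[of s t c] that w_nonneg[of s t] by fastforce
  have only_a: "w s t \<le> w s a * (1 - w t a) + w t a * (1 - w s a) + 3 * \<epsilon>"
    if st: "s \<in> V" "t \<in> V" "w s b = 0" "0 < w t a" "1 - \<epsilon> \<le> w s a + w s b" for s t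
  proof -
    have r: "0 \<le> w s a" "w s a \<le> 1" "0 \<le> w t a" "w t a \<le> 1" using st V w_nonneg w_le_1 by auto
    have "(1 - \<epsilon>) * (1 - w t a) \<le> w s a * (1 - w t a)" using st r by (intro mult_right_mono) auto
    moreover have "\<epsilon> * (1 - w t a) \<le> \<epsilon>" using r \<epsilon> by (simp add: mult_left_le)
    ultimately have "1 - w t a - \<epsilon> \<le> w s a * (1 - w t a)" by (simp add: algebra_simps)
    moreover have "0 \<le> w t a * (1 - w s a)" "0 \<le> w s a * (1 - w t a)" using r by auto
    ultimately show ?thesis using tri[of s t a] st V \<epsilon> by auto
  qed
  have only_b: "w s t \<le> w s a * (1 - w t a) + w t a * (1 - w s a) + 3 * \<epsilon>"
    if st: "s \<in> V" "t \<in> V" "w s a = 0" "0 < w t b" "1 - \<epsilon> \<le> w s a + w s b" "1 - \<epsilon> \<le> w t a + w t b" for s t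
    using tri[of s t b] st V \<epsilon> w_nonneg[of t a] by auto
  have swap: "w v u = w u v" using V w_sym by auto
  have zero_or_pos: "x = 0 \<or> 0 < x" if "0 \<le> x" for x :: real using that by linarith
  consider "0 < w u a" "0 < w u b" "0 < w v a" "0 < w v b"
    | "w u b = 0" "0 < w v a" | "w u b = 0" "w v a = 0"
    | "w u a = 0" "0 < w v b" | "w u a = 0" "w v b = 0"
    | "w v b = 0" "0 < w u a" | "w v a = 0" "0 < w u b"
    using zero_or_pos[OF r(1)] zero_or_pos[OF r(3)] zero_or_pos[OF r(5)] zero_or_pos[OF r(7)] by blast
  then show ?thesis
  proof cases
    case 1
    then show ?thesis using two_neighbours_light[OF V ab \<epsilon> u v] g by linarith
  next
    case 2 then show ?thesis using only_a[of u v] V u by auto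
  next
    case 3 then show ?thesis using u r \<epsilon> by auto
  next
    case 4 then show ?thesis using only_b[of u v] V u v by auto
  next
    case 5 then show ?thesis using v r \<epsilon> by auto
  next
    case 6 then show ?thesis using only_a[of v u] V v swap by auto
  next
    case 7 then show ?thesis using only_b[of v u] V u v swap by auto
  qed
qed

text \<open>Triangles on \<open>a b\<close> bound \<open>w v a + w v b\<close> by \<open>1 + \<eta>\<close>, and the degrees of \<open>a\<close> and \<open>b\<close> force the
  average to be almost 1.\<close>

lemma few_bad_for_heavy_edge:
  assumes V: "a \<in> V" "b \<in> V" and ab: "1 - \<eta> \<le> w a b" and \<eta>: "0 \<le> \<eta>" "\<eta> < 1"
    and deg: "(1/2 - \<beta>) * real (card V) \<le> degree a" "(1/2 - \<beta>) * real (card V) \<le> degree b"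
    and \<epsilon>: "0 \<le> \<epsilon>"
  shows "real (card {v\<in>V. w v a + w v b < 1 - \<epsilon>}) * \<epsilon> \<le> (\<eta> + 2 * \<beta>) * real (card V)"
proof -
  have "real (card {v\<in>V. w v a + w v b < 1 - \<epsilon>}) * \<epsilon> \<le> (\<Sum>v\<in>V. 1 + \<eta> - (w v a + w v b))"
  proof (rule sum_ge_card_mult)
    show "0 \<le> 1 + \<eta> - (w v a + w v b)" if v: "v \<in> V" for v
    proof (cases "0 < w v a \<and> 0 < w v b")
      case True
      then show ?thesis using triangle_weight[of v a b] V v ab \<eta> by auto
    next
      case False
      then show ?thesis using w_le_1[of v a] w_le_1[of v b] V v \<eta> by auto
    qed
  qed (use \<eta> in \<open>auto simp: finite_V\<close>)
  also have "\<dots> = (1 + \<eta>) * real (card V) - ((\<Sum>v\<in>V. w v a) + (\<Sum>v\<in>V. w v b))"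
    by (simp add: sum_subtractf sum.distrib)
  also have "(\<Sum>v\<in>V. w v a) = degree a"
    using V w_sym by (auto simp: degree_def intro!: sum.cong)
  also have "(\<Sum>v\<in>V. w v b) = degree b"
    using V w_sym by (auto simp: degree_def intro!: sum.cong)
  also have "(1 + \<eta>) * real (card V) - (degree a + degree b) \<le> (\<eta> + 2 * \<beta>) * real (card V)"
    using deg by (simp add: algebra_simps)
  finally show ?thesis .
qed

section \<open>From a profile to a cut\<close>

text \<open>The slack \<open>h u v\<close> of the cut estimate is nonnegative, and its sum is at most
  \<open>3/2 * t^4 * n\<^sup>2 - 2 * (P - n/2)\<^sup>2\<close>. Hence \<open>P\<close> is close to \<open>n/2\<close>. Two vertices of \<open>G\<close> with
  intermediate profile have slack at least \<open>2 * t\<^sup>2\<close>, so there are at most \<open>t * n\<close> of them. Between the two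
  extreme classes the separation probability is at least \<open>1 - 2 * t\<close>, so missing weight there is paid
  for by slack.\<close>

lemma near_cut_of_profile:
  fixes p :: "'a \<Rightarrow> real"
  assumes total: "(1/2 - t^4/2) * (real (card V))\<^sup>2 \<le> (\<Sum>u\<in>V. degree u)"
    and t: "0 < t" "t < 1/2" and p: "\<And>v. v \<in> V \<Longrightarrow> 0 \<le> p v" "\<And>v. v \<in> V \<Longrightarrow> p v \<le> 1"
    and G: "G \<subseteq> V" "real (card (V - G)) \<le> t^4/4 * real (card V)"
    and cut: "\<And>u v. u \<in> G \<Longrightarrow> v \<in> G \<Longrightarrow> w u v \<le> p u * (1 - p v) + p v * (1 - p u) + t^4/2"
    and mid: "\<And>u v. u \<in> G \<Longrightarrow> v \<in> G \<Longrightarrow> t < p u \<Longrightarrow> p u < 1 - t \<Longrightarrow> t < p v \<Longrightarrow> p v < 1 - t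
      \<Longrightarrow> w u v \<le> t^4/2"
  shows "\<exists>X Y. X \<subseteq> V \<and> Y \<subseteq> V \<and> X \<inter> Y = {}
    \<and> (1/2 - 4 * t) * real (card V) \<le> real (card X) \<and> (1/2 - 4 * t) * real (card V) \<le> real (card Y)
    \<and> (\<Sum>u\<in>X. \<Sum>v\<in>Y. 1 - w u v) \<le> 4 * t * (real (card V))\<^sup>2"
proof -
  define N where "N = real (card V)"
  have N: "0 \<le> N" by (simp add: N_def)
  define P where "P = (\<Sum>v\<in>V. p v)"
  define g where "g u v = p u * (1 - p v) + p v * (1 - p u)" for u v
  \<comment> \<open>The term \<open>bad\<close> keeps the slack nonnegative at pairs about which nothing is known.\<close>
  define bad where "bad u v = (if u \<in> G \<and> v \<in> G then 0 else 1 :: real)" for u v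
  define h where "h u v = g u v - w u v + t^4/2 + bad u v" for u v
  have g_nonneg: "0 \<le> g u v" if "u \<in> V" "v \<in> V" for u v using p that by (simp add: g_def)
  have h_nonneg: "0 \<le> h u v" if "u \<in> V" "v \<in> V" for u v
  proof (cases "u \<in> G \<and> v \<in> G")
    case True then show ?thesis using cut[of u v] by (simp add: h_def g_def bad_def)
  next
    case False
    have "0 \<le> t^4/2" using t by simp
    moreover have "bad u v = 1" using False by (simp add: bad_def)
    ultimately show ?thesis using w_le_1[OF that] g_nonneg[OF that] unfolding h_def by linarith
  qed
  have finG: "finite G" using G finite_V finite_subset by blast
  have sum_g: "(\<Sum>u\<in>V. \<Sum>v\<in>V. g u v) = 2 * P * (N - P)"
  proof -
    have "(\<Sum>v\<in>V. g u v) = p u * (N - P) + P * (1 - p u)" for u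
      by (simp add: g_def sum.distrib sum_distrib_left[symmetric] sum_distrib_right[symmetric]
        sum_subtractf N_def P_def)
    then show ?thesis
      by (simp add: sum.distrib sum_distrib_left[symmetric] sum_distrib_right[symmetric]
        sum_subtractf N_def P_def)
  qed
  have sum_bad: "(\<Sum>u\<in>V. \<Sum>v\<in>V. bad u v) \<le> t^4/2 * N\<^sup>2"
  proof -
    have ind: "(\<Sum>v\<in>V. if v \<in> G then 0 else (1::real)) = real (card (V - G))"
      using finite_V by (simp add: sum.If_cases Diff_eq)
    have "(\<Sum>u\<in>V. \<Sum>v\<in>V. bad u v)
        \<le> (\<Sum>u\<in>V. \<Sum>v\<in>V. (if u \<in> G then 0 else 1) + (if v \<in> G then 0 else 1))"
      by (intro sum_mono) (auto simp: bad_def)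
    also have "\<dots> = 2 * real (card (V - G)) * N"
      by (simp only: sum.distrib ind) (simp add: N_def sum_distrib_left[symmetric] ind)
    also have "\<dots> \<le> 2 * (t^4/4 * N) * N"
      using G N by (intro mult_right_mono mult_left_mono) (auto simp: N_def)
    finally show ?thesis by (simp add: power2_eq_square algebra_simps)
  qed
  have "(\<Sum>u\<in>V. \<Sum>v\<in>V. h u v) = (\<Sum>u\<in>V. \<Sum>v\<in>V. g u v) - (\<Sum>u\<in>V. degree u)
      + t^4/2 * N\<^sup>2 + (\<Sum>u\<in>V. \<Sum>v\<in>V. bad u v)"
    by (simp add: h_def sum.distrib sum_subtractf degree_def N_def power2_eq_square)
  also have "\<dots> \<le> 2 * P * (N - P) - (1/2 - t^4/2) * N\<^sup>2 + t^4/2 * N\<^sup>2 + t^4/2 * N\<^sup>2"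
    using sum_g sum_bad total by (simp add: N_def)
  also have "\<dots> = 3/2 * t^4 * N\<^sup>2 - 2 * (P - N/2)\<^sup>2"
    by (simp add: power2_eq_square algebra_simps)
  finally have sum_h: "(\<Sum>u\<in>V. \<Sum>v\<in>V. h u v) \<le> 3/2 * t^4 * N\<^sup>2 - 2 * (P - N/2)\<^sup>2" .
  have tN: "0 \<le> t^4 * N\<^sup>2" using t by simp
  have sum_h_le: "(\<Sum>u\<in>V. \<Sum>v\<in>V. h u v) \<le> 2 * t^4 * N\<^sup>2"
    using sum_h tN zero_le_power2[of "P - N/2"] by linarith
  have "0 \<le> (\<Sum>u\<in>V. \<Sum>v\<in>V. h u v)" by (intro sum_nonneg h_nonneg)
  then have "(P - N/2)\<^sup>2 \<le> t^4 * N\<^sup>2" using sum_h tN by linarith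
  also have "\<dots> = (t\<^sup>2 * N)\<^sup>2" by (simp add: power_mult_distrib flip: power_mult)
  finally have "\<bar>P - N/2\<bar> \<le> t\<^sup>2 * N" using N by (simp add: abs_le_square_iff[symmetric])
  moreover have "t\<^sup>2 * N \<le> t * N"
    using t N by (intro mult_right_mono) (auto simp: power2_eq_square mult_left_le)
  ultimately have P: "N/2 - t * N \<le> P" "P \<le> N/2 + t * N" by linarith+
  define M where "M = {u\<in>G. t < p u \<and> p u < 1 - t}"
  have M: "M \<subseteq> V" "M \<subseteq> G" using G by (auto simp: M_def)
  have finM: "finite M" using M finite_V finite_subset by blast
  have M_small: "real (card M) \<le> t * N"
  proof -
    have "real (card (M \<times> M)) * (2 * t\<^sup>2) \<le> (\<Sum>z\<in>V \<times> V. h (fst z) (snd z))"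
    proof (rule sum_ge_card_mult)
      show "2 * t\<^sup>2 \<le> h (fst z) (snd z)" if zM: "z \<in> M \<times> M" for z
      proof -
        obtain u v where z: "z = (u, v)" "u \<in> M" "v \<in> M" using zM by auto
        have "t * t \<le> p u * (1 - p v)" "t * t \<le> p v * (1 - p u)"
          using z t by (auto simp: M_def intro!: mult_mono)
        moreover have "w u v \<le> t^4/2" using mid[of u v] z by (simp add: M_def)
        ultimately show ?thesis using z M by (auto simp: h_def g_def bad_def power2_eq_square)
      qed
    qed (use finite_V M h_nonneg in auto)
    also have "\<dots> = (\<Sum>u\<in>V. \<Sum>v\<in>V. h u v)" by (simp add: sum.cartesian_product split_def)
    also have "\<dots> \<le> 2 * t^4 * N\<^sup>2" by (rule sum_h_le)
    also have "\<dots> = (t * N)\<^sup>2 * (2 * t\<^sup>2)" by (simp add: power2_eq_square power4_eq_xxxx)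
    finally have "(real (card M))\<^sup>2 * (2 * t\<^sup>2) \<le> (t * N)\<^sup>2 * (2 * t\<^sup>2)"
      by (simp only: card_cartesian_product of_nat_mult power2_eq_square)
    moreover have "0 < 2 * t\<^sup>2" using t by simp
    ultimately have "(real (card M))\<^sup>2 \<le> (t * N)\<^sup>2" by (rule mult_right_le_imp_le)
    then show ?thesis using t N by (simp add: power2_le_iff_abs_le)
  qed
  have "t^4 \<le> t" using t power_decreasing[of 1 4 t] by simp
  then have G_small: "real (card (V - G)) \<le> t * N"
    using G(2) mult_right_mono[of "t^4/4" t N] N t by (auto simp: N_def)
  define X where "X = {u\<in>V. 1 - t \<le> p u}"
  define Y where "Y = {u\<in>V. p u \<le> t}"
  define Z where "Z = M \<union> (V - G)"
  have fin: "finite X" "finite Y" "finite Z" using finite_V finM by (auto simp: X_def Y_def Z_def)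
  have sub: "X \<subseteq> V" "Y \<subseteq> V" "Z \<subseteq> V" and V_cover: "\<And>v. v \<in> V \<Longrightarrow> v \<in> X \<or> v \<in> Y \<or> v \<in> Z"
    using M by (auto simp: X_def Y_def Z_def M_def)
  have Z_small: "real (card Z) \<le> 2 * t * N"
    using card_Un_le[of M "V - G"] M_small G_small unfolding Z_def by linarith
  have count: "(\<Sum>v\<in>V. q v) \<le> real (card A) + 3 * t * N"
    if "A \<subseteq> V" "\<And>v. v \<in> V \<Longrightarrow> q v \<le> 1" "\<And>v. v \<in> V \<Longrightarrow> v \<in> A \<or> q v \<le> t \<or> v \<in> Z"
    for A and q :: "'a \<Rightarrow> real"
  proof -
    have "(\<Sum>v\<in>V. q v) \<le> (\<Sum>v\<in>V. (if v \<in> A then 1 else 0) + t + (if v \<in> Z then 1 else 0))"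
      using that t by (intro sum_mono) fastforce
    also have "\<dots> = real (card A) + t * N + real (card Z)"
      using finite_V that(1) sub(3)
      by (simp add: sum.distrib sum.If_cases Int_absorb1 N_def)
    finally show ?thesis using Z_small by linarith
  qed
  have "P \<le> real (card X) + 3 * t * N"
    unfolding P_def using p V_cover sub by (intro count) (auto simp: Y_def)
  then have X_large: "(1/2 - 4 * t) * N \<le> real (card X)" using P by (simp add: algebra_simps)
  have "N - P = (\<Sum>v\<in>V. 1 - p v)" by (simp add: P_def N_def sum_subtractf)
  also have "\<dots> \<le> real (card Y) + 3 * t * N"
    using p V_cover sub by (intro count) (fastforce simp: X_def)+
  finally have Y_large: "(1/2 - 4 * t) * N \<le> real (card Y)" using P by (simp add: algebra_simps)
  have "(\<Sum>u\<in>X. \<Sum>v\<in>Y. 1 - w u v) \<le> (\<Sum>u\<in>X. \<Sum>v\<in>Y. h u v + 2 * t)"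
  proof (intro sum_mono)
    fix u v assume uv: "u \<in> X" "v \<in> Y"
    then have "(1 - t) * (1 - t) \<le> p u * (1 - p v)" "0 \<le> p v * (1 - p u)"
      using t p by (auto simp: X_def Y_def intro!: mult_mono)
    moreover have "1 - 2 * t \<le> (1 - t) * (1 - t)" by (simp add: algebra_simps)
    ultimately have "1 - 2 * t \<le> g u v" unfolding g_def by linarith
    moreover have "g u v - w u v \<le> h u v" using t by (simp add: h_def bad_def)
    ultimately show "1 - w u v \<le> h u v + 2 * t" by linarith
  qed
  also have "\<dots> \<le> (\<Sum>u\<in>V. \<Sum>v\<in>V. h u v + 2 * t)"
  proof -
    have "(\<Sum>u\<in>X. \<Sum>v\<in>Y. h u v + 2 * t) \<le> (\<Sum>u\<in>X. \<Sum>v\<in>V. h u v + 2 * t)"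
      using finite_V sub h_nonneg t by (intro sum_mono sum_mono2) (auto simp: subset_iff intro!: add_nonneg_nonneg)
    also have "\<dots> \<le> (\<Sum>u\<in>V. \<Sum>v\<in>V. h u v + 2 * t)"
      using finite_V sub h_nonneg t by (intro sum_mono2 sum_nonneg) (auto intro!: add_nonneg_nonneg)
    finally show ?thesis .
  qed
  also have "\<dots> = (\<Sum>u\<in>V. \<Sum>v\<in>V. h u v) + 2 * t * N\<^sup>2"
    by (simp add: sum.distrib N_def power2_eq_square)
  also have "\<dots> \<le> (2 * t^4 + 2 * t) * N\<^sup>2" using sum_h_le by (simp add: algebra_simps)
  also have "\<dots> \<le> (4 * t) * N\<^sup>2" using \<open>t^4 \<le> t\<close> by (intro mult_right_mono) auto
  finally have "(\<Sum>u\<in>X. \<Sum>v\<in>Y. 1 - w u v) \<le> 4 * t * N\<^sup>2" .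
  moreover have "X \<inter> Y = {}" using t by (auto simp: X_def Y_def)
  ultimately show ?thesis using X_large Y_large sub unfolding N_def by blast
qed

text \<open>The parameters are chosen from the coarse one, \<open>t\<close>, to the fine one, \<open>\<tau>\<close>. The defect \<open>\<epsilon> = t^4 / 6\<close>
  of a profile turns the error \<open>3 * \<epsilon>\<close> of the cut estimate into \<open>t^4 / 2\<close>; \<open>\<eta>\<close> is such that at most
  \<open>2 * \<eta> / \<epsilon> = t^4 / 4\<close> of the vertices have a larger defect; and \<open>\<tau>\<close> is small enough for an
  edge of weight \<open>1 - \<eta>\<close> to exist between vertices of degree at least \<open>(1/2 - \<eta>/2) * n\<close>.\<close>

lemma near_bipartite:
  assumes t: "0 < t" "t < 1/2" and \<eta>: "\<eta> = t^8 / 48" and \<tau>: "\<tau> = \<eta>^3 / 2000"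
    and total: "(1/2 - \<tau>\<^sup>2) * (real (card V))\<^sup>2 \<le> (\<Sum>u\<in>V. degree u)" and V: "V \<noteq> {}"
  shows "\<exists>X Y. X \<subseteq> V \<and> Y \<subseteq> V \<and> X \<inter> Y = {}
    \<and> (1/2 - 4 * t) * real (card V) \<le> real (card X) \<and> (1/2 - 4 * t) * real (card V) \<le> real (card Y)
    \<and> (\<Sum>u\<in>X. \<Sum>v\<in>Y. 1 - w u v) \<le> 4 * t * (real (card V))\<^sup>2"
proof -
  define N where "N = real (card V)"
  define \<epsilon> where "\<epsilon> = t^4 / 6"
  have t_pow: "t^m \<le> t" if "0 < m" for m using power_decreasing[of 1 m t] that t by simp
  have \<eta>_bounds: "0 < \<eta>" "\<eta> \<le> 1" using t t_pow[of 8] by (auto simp: \<eta>)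
  have \<epsilon>_bounds: "0 < \<epsilon>" "\<epsilon> < t" "\<epsilon> < 1" using t t_pow[of 4] by (auto simp: \<epsilon>_def)
  have \<epsilon>\<eta>: "2 * \<eta> = t^4/4 * \<epsilon>" by (simp add: \<eta> \<epsilon>_def flip: power_add)
  have "\<eta> \<le> \<epsilon>"
  proof -
    have "t^4/4 * \<epsilon> \<le> 1 * \<epsilon>" using \<epsilon>_bounds t t_pow[of 4] by (intro mult_right_mono) auto
    then show ?thesis using \<epsilon>\<eta> \<eta>_bounds by linarith
  qed
  have \<eta>_pow: "\<eta>^3 \<le> \<eta>\<^sup>2" "\<eta>^2 \<le> 1"
    using \<eta>_bounds by (auto intro: power_decreasing power_le_one)
  have \<tau>_bounds: "0 < \<tau>" "\<tau> \<le> 1" using \<eta>_bounds \<eta>_pow by (auto simp: \<tau>)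
  have \<tau>2: "\<tau>\<^sup>2 \<le> \<tau>" using \<tau>_bounds by (simp add: power2_eq_square mult_left_le)
  have small: "\<tau>\<^sup>2 + 4 * \<tau> / (\<eta>/2) \<le> \<eta>\<^sup>2 / 200"
  proof -
    have "4 * \<tau> / (\<eta>/2) = \<eta>\<^sup>2 / 250"
      using \<eta>_bounds by (simp add: \<tau> power2_eq_square power3_eq_cube)
    moreover have "\<tau>\<^sup>2 \<le> \<eta>\<^sup>2 / 2000" using \<tau>2 \<eta>_pow by (simp add: \<tau>)
    ultimately show ?thesis using zero_le_power2[of \<eta>] by linarith
  qed
  obtain a b where ab: "a \<in> V" "b \<in> V" "1 - \<eta> < w a b"
      "(1/2 - \<eta>/2) * N \<le> degree a" "(1/2 - \<eta>/2) * N \<le> degree b"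
    using exists_heavy_edge[OF total \<tau>_bounds _ \<eta>_bounds small V] \<eta>_bounds by (auto simp: N_def)
  define G where "G = {v\<in>V. 1 - \<epsilon> \<le> w v a + w v b}"
  have ab_\<epsilon>: "1 - \<epsilon> \<le> w a b" using ab \<open>\<eta> \<le> \<epsilon>\<close> by linarith
  have "V - G = {v\<in>V. w v a + w v b < 1 - \<epsilon>}" by (auto simp: G_def)
  then have "real (card (V - G)) * \<epsilon> \<le> (\<eta> + 2 * (\<eta>/2)) * N"
    using few_bad_for_heavy_edge[of a b \<eta> "\<eta>/2" \<epsilon>] ab \<eta>_bounds \<epsilon>_bounds \<open>\<eta> \<le> \<epsilon>\<close>
    by (simp add: N_def)
  also have "\<dots> = (t^4/4 * N) * \<epsilon>" using \<epsilon>\<eta> by (simp add: algebra_simps)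
  finally have G_large: "real (card (V - G)) \<le> t^4/4 * N" using \<epsilon>_bounds by simp
  have G: "v \<in> V" "1 - \<epsilon> \<le> w v a + w v b" if "v \<in> G" for v using that by (auto simp: G_def)
  show ?thesis
  proof (rule near_cut_of_profile[where p = "\<lambda>v. w v a" and G = G])
    have "\<tau>\<^sup>2 \<le> t^4/2"
      using \<tau>2 \<eta>_pow \<eta>_bounds \<epsilon>\<eta> \<open>\<eta> \<le> \<epsilon>\<close> \<epsilon>_bounds
        power_decreasing[of 1 3 \<eta>] by (simp add: \<tau> \<epsilon>_def)
    then have "(1/2 - t^4/2) * N\<^sup>2 \<le> (1/2 - \<tau>\<^sup>2) * N\<^sup>2" by (intro mult_right_mono) auto
    then show "(1/2 - t^4/2) * (real (card V))\<^sup>2 \<le> (\<Sum>u\<in>V. degree u)"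
      using total by (simp add: N_def)
  next
    fix u v assume uv: "u \<in> G" "v \<in> G"
    show "w u v \<le> w u a * (1 - w v a) + w v a * (1 - w u a) + t^4/2"
      using weight_le_cut_probability[OF ab(1,2) G(1)[OF uv(1)] G(1)[OF uv(2)] ab_\<epsilon> \<epsilon>_bounds(3)]
        \<epsilon>_bounds G uv by (simp add: \<epsilon>_def)
    assume mid: "t < w u a" "w u a < 1 - t" "t < w v a" "w v a < 1 - t"
    have "0 < w u b" "0 < w v b" using mid G(2) uv \<epsilon>_bounds by fastforce+
    then show "w u v \<le> t^4/2"
      using two_neighbours_light[OF ab(1,2) G(1)[OF uv(1)] G(1)[OF uv(2)] ab_\<epsilon> \<epsilon>_bounds(3)]
        \<epsilon>_bounds G uv mid t by (simp add: \<epsilon>_def)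
  next
    show "G \<subseteq> V" by (auto simp: G_def)
  qed (use t ab w_nonneg w_le_1 G_large in \<open>auto simp: N_def\<close>)
qed

end

section \<open>The stability theorem\<close>

lemma sum_symmetric_eq_double_weight_within:
  assumes "finite S" "\<And>i j. i \<in> S \<Longrightarrow> j \<in> S \<Longrightarrow> w i j = w j i" "\<And>i. i \<in> S \<Longrightarrow> w i i = 0"
  shows "(\<Sum>i\<in>S. \<Sum>j\<in>S. w i j) = 2 * weight_within w S"
proof -
  define L where "L = {(i, j). i \<in> S \<and> j \<in> S \<and> i < j}"
  define R where "R = {(i, j). i \<in> S \<and> j \<in> S \<and> j < i}"
  define D where "D = {(i, j). i \<in> S \<and> j = i}"
  have SS: "S \<times> S = L \<union> R \<union> D" by (auto simp: L_def R_def D_def)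
  have fin: "finite (L \<union> R \<union> D)" unfolding SS[symmetric] using assms(1) by simp
  have "(\<Sum>i\<in>S. \<Sum>j\<in>S. w i j) = (\<Sum>(i, j)\<in>L \<union> R \<union> D. w i j)"
    by (simp add: sum.cartesian_product SS)
  also have "\<dots> = (\<Sum>(i, j)\<in>L \<union> R. w i j) + (\<Sum>(i, j)\<in>D. w i j)"
    using fin by (intro sum.union_disjoint) (auto simp: L_def R_def D_def)
  also have "(\<Sum>(i, j)\<in>L \<union> R. w i j) = (\<Sum>(i, j)\<in>L. w i j) + (\<Sum>(i, j)\<in>R. w i j)"
    using fin by (intro sum.union_disjoint) (auto simp: L_def R_def)
  also have "(\<Sum>(i, j)\<in>D. w i j) = 0" by (rule sum.neutral) (auto simp: D_def assms(3))
  also have "(\<Sum>(i, j)\<in>R. w i j) = (\<Sum>(i, j)\<in>L. w i j)"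
    by (rule sum.reindex_bij_witness[of _ prod.swap prod.swap])
      (auto simp: L_def R_def intro: assms(2))
  finally show ?thesis by (simp add: weight_within_def L_def)
qed

lemma clique_sparse_of_edge_weighting:
  assumes w: "edge_weighting n w"
    and sparse: "\<forall>S \<subseteq> {1..n}. S \<noteq> {} \<longrightarrow> induces_clique (positive_support n w) S \<longrightarrow>
         weight_within w S \<le> real (card S) - 1"
  shows "clique_sparse {1..n} w"
proof
  fix S assume S: "S \<subseteq> {1..n}" "S \<noteq> {}" and pos: "\<And>u v. u \<in> S \<Longrightarrow> v \<in> S \<Longrightarrow> u \<noteq> v \<Longrightarrow> 0 < w u v"
  have "induces_clique (positive_support n w) S"
    unfolding induces_clique_def positive_support_def using S pos by blast
  then have "weight_within w S \<le> real (card S) - 1" using sparse S by blast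
  moreover have "(\<Sum>u\<in>S. \<Sum>v\<in>S. w u v) = 2 * weight_within w S"
    using w S finite_subset[OF S(1)]
    by (intro sum_symmetric_eq_double_weight_within) (auto simp: edge_weighting_def subset_iff)
  ultimately show "(\<Sum>u\<in>S. \<Sum>v\<in>S. w u v) \<le> 2 * (real (card S) - 1)" by simp
qed (use w in \<open>auto simp: edge_weighting_def\<close>)

theorem lemma2p4:
  shows "\<forall>\<theta>>0::real. \<exists>\<delta>>0::real. \<forall>\<^sub>F n in sequentially.
    \<forall>w :: nat \<Rightarrow> nat \<Rightarrow> real.
      edge_weighting n w \<longrightarrow>
      (\<forall>S \<subseteq> {1..n}. S \<noteq> {} \<longrightarrow> induces_clique (positive_support n w) S \<longrightarrow>
         weight_within w S \<le> real (card S) - 1) \<longrightarrow>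
      weight_within w {1..n} \<ge> (1/4 - \<delta>) * (real n)\<^sup>2 \<longrightarrow>
      (\<exists>A B. balanced_bipartition {1..n} A B \<and>
         (\<Sum>a\<in>A. \<Sum>b\<in>B. 1 - w a b) \<le> \<theta> * (real n)\<^sup>2)"
proof (intro allI impI)
  fix \<theta> :: real assume \<theta>: "0 < \<theta>"
  \<comment> \<open>The cut between the extreme classes costs \<open>4 * t * n\<^sup>2\<close>; balancing with \<open>\<kappa> = 4 * t\<close> costs
    \<open>12 * t * n\<^sup>2 + n\<close>, which is at most \<open>13 * t * n\<^sup>2\<close> once \<open>n \<ge> 1 / t\<close>.\<close>
  define t where "t = min 1 \<theta> / 17"
  have t: "0 < t" "t < 1/2" "17 * t \<le> \<theta>" using \<theta> by (auto simp: t_def)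
  define \<tau> where "\<tau> = (t^8/48)^3 / 2000"
  have \<tau>: "0 < \<tau>\<^sup>2 / 2" using t by (simp add: \<tau>_def)
  have large: "\<forall>\<^sub>F n in sequentially. 1 / t \<le> real n"
    using filterlim_real_sequentially by (simp add: filterlim_at_top)
  show "\<exists>\<delta>>0::real. \<forall>\<^sub>F n in sequentially.
    \<forall>w :: nat \<Rightarrow> nat \<Rightarrow> real.
      edge_weighting n w \<longrightarrow>
      (\<forall>S \<subseteq> {1..n}. S \<noteq> {} \<longrightarrow> induces_clique (positive_support n w) S \<longrightarrow>
         weight_within w S \<le> real (card S) - 1) \<longrightarrow>
      weight_within w {1..n} \<ge> (1/4 - \<delta>) * (real n)\<^sup>2 \<longrightarrow>
      (\<exists>A B. balanced_bipartition {1..n} A B \<and>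
         (\<Sum>a\<in>A. \<Sum>b\<in>B. 1 - w a b) \<le> \<theta> * (real n)\<^sup>2)"
  proof (intro exI[of _ "\<tau>\<^sup>2 / 2"] conjI \<tau>, rule eventually_mono[OF large], intro allI impI)
    fix n and w :: "nat \<Rightarrow> nat \<Rightarrow> real"
    assume n: "1 / t \<le> real n" and w: "edge_weighting n w"
      and sparse: "\<forall>S \<subseteq> {1..n}. S \<noteq> {} \<longrightarrow> induces_clique (positive_support n w) S \<longrightarrow>
         weight_within w S \<le> real (card S) - 1"
      and dense: "(1/4 - \<tau>\<^sup>2 / 2) * (real n)\<^sup>2 \<le> weight_within w {1..n}"
    interpret clique_sparse "{1..n}" w
      using w sparse by (rule clique_sparse_of_edge_weighting)
    have n1: "1 \<le> t * real n" using n t by (simp add: field_simps)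
    then have "{1..n} \<noteq> {}" by (cases n) auto
    have "(\<Sum>u\<in>{1..n}. degree u) = 2 * weight_within w {1..n}"
      unfolding degree_def
      by (rule sum_symmetric_eq_double_weight_within) (use w_sym w_irrefl in auto)
    then have total: "(1/2 - \<tau>\<^sup>2) * (real (card {1..n}))\<^sup>2 \<le> (\<Sum>u\<in>{1..n}. degree u)"
      using dense by (simp add: algebra_simps)
    obtain X Y where XY: "X \<subseteq> {1..n}" "Y \<subseteq> {1..n}" "X \<inter> Y = {}"
        "(1/2 - 4 * t) * real (card {1..n}) \<le> real (card X)"
        "(1/2 - 4 * t) * real (card {1..n}) \<le> real (card Y)"
        "(\<Sum>u\<in>X. \<Sum>v\<in>Y. 1 - w u v) \<le> 4 * t * (real (card {1..n}))\<^sup>2"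
      using near_bipartite[OF t(1,2) refl \<tau>_def total \<open>{1..n} \<noteq> {}\<close>] by blast
    obtain A B where AB: "balanced_bipartition {1..n} A B"
        "(\<Sum>a\<in>A. \<Sum>b\<in>B. 1 - w a b)
          \<le> (\<Sum>a\<in>X. \<Sum>b\<in>Y. 1 - w a b) + (3 * (4 * t) * real (card {1..n}) + 1) * real (card {1..n})"
      using exists_balanced_cut_close_to[of "{1..n}" X Y "\<lambda>a b. 1 - w a b" "4 * t"]
        XY(1-5) w_nonneg w_le_1 t by auto
    have "(\<Sum>a\<in>A. \<Sum>b\<in>B. 1 - w a b) \<le> 4 * t * (real n)\<^sup>2 + (12 * t * real n + 1) * real n"
      using AB(2) XY(6) by simp
    also have "\<dots> \<le> 4 * t * (real n)\<^sup>2 + (13 * (t * real n)) * real n"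
      using n1 by (intro add_left_mono mult_right_mono) auto
    also have "\<dots> = 17 * t * (real n)\<^sup>2" by (simp add: power2_eq_square)
    also have "\<dots> \<le> \<theta> * (real n)\<^sup>2" using t by (intro mult_right_mono) auto
    finally show "\<exists>A B. balanced_bipartition {1..n} A B \<and>
         (\<Sum>a\<in>A. \<Sum>b\<in>B. 1 - w a b) \<le> \<theta> * (real n)\<^sup>2"
      using AB(1) by blast
  qed
qed

end
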